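(* Let $H$ be a Hadamard matrix of order $v^2$. Then there exists a $\mathcal{C}^3_3\big(v^6,\ v^8(v^4-1)/2,\ v^8(v^4-2)/4\big)$-cube containing a $\mathcal{C}^3_3\big(v^3,\ v^4(v^2-1)/2,\ v^4(v^2-2)/4\big)$-cube as a subcube.
   Context: A $w\times w\times w$ array is a function on $\{1,\dots,w\}^3$. A layer is obtained by fixing one of the three coordinates; two layers are parallel if they fix the same coordinate, to different values; their scalar product is the sum over all positions of the product of corresponding entries. $\mathcal{C}^3_3(w,k,\lambda)$ is the set of $w\times w\times w$ arrays over $\{0,1\}$ such that every layer (in each of the three directions) contains exactly $k$ ones and every two parallel layers have scalar product $\lambda$; its elements are called $\mathcal{C}^3_3(w,k,\lambda)$-cubes. A subcube of an array is the array obtained by restricting each of the three coordinates to a subset of the index set, the three subsets having the same size. A Hadamard matrix of order $n$ is an $n\times n$ matrix over $\{1,-1\}$ whose distinct rows are orthogonal and whose distinct columns are orthogonal. *)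

theory Defs
  imports "Jordan_Normal_Form.Matrix"
begin

definition hadamard_matrix :: "nat \<Rightarrow> int mat \<Rightarrow> bool" where
  "hadamard_matrix n H \<longleftrightarrow>
     H \<in> carrier_mat n n \<and>
     (\<forall>i<n. \<forall>j<n. H $$ (i, j) \<in> {1, -1}) \<and>
     (\<forall>i<n. \<forall>j<n. i \<noteq> j \<longrightarrow> row H i \<bullet> row H j = 0) \<and>
     (\<forall>i<n. \<forall>j<n. i \<noteq> j \<longrightarrow> col H i \<bullet> col H j = 0)"

type_synonym array3 = "nat \<times> nat \<times> nat \<Rightarrow> nat"

abbreviation index_cube :: "nat \<Rightarrow> (nat \<times> nat \<times> nat) set" where
  "index_cube w \<equiv> {1..w} \<times> {1..w} \<times> {1..w}"

abbreviation index_square :: "nat \<Rightarrow> (nat \<times> nat) set" where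
  "index_square w \<equiv> {1..w} \<times> {1..w}"

definition layer1 :: "array3 \<Rightarrow> nat \<Rightarrow> nat \<times> nat \<Rightarrow> nat" where
  "layer1 A a = (\<lambda>(p, q). A (a, p, q))"

definition layer2 :: "array3 \<Rightarrow> nat \<Rightarrow> nat \<times> nat \<Rightarrow> nat" where
  "layer2 A a = (\<lambda>(p, q). A (p, a, q))"

definition layer3 :: "array3 \<Rightarrow> nat \<Rightarrow> nat \<times> nat \<Rightarrow> nat" where
  "layer3 A a = (\<lambda>(p, q). A (p, q, a))"

(* k and lambda are real so that quotients such as v^4 (v^2 - 2) / 4 are exact,
   with no truncated subtraction or division.  Only for w \<le> 1, where there are
   no two distinct parallel layers, is lambda unconstrained (in particular it
   may then be negative or fractional). *)
definition C33 :: "nat \<Rightarrow> real \<Rightarrow> real \<Rightarrow> array3 set" where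
  "C33 w k lam =
     {A \<in> index_cube w \<rightarrow>\<^sub>E {0, 1}.
        \<forall>L \<in> {layer1, layer2, layer3}.
          (\<forall>a\<in>{1..w}. real (card {p \<in> index_square w. L A a p = 1}) = k) \<and>
          (\<forall>a\<in>{1..w}. \<forall>b\<in>{1..w}. a \<noteq> b \<longrightarrow>
             real (\<Sum>p\<in>index_square w. L A a p * L A b p) = lam)}"

(* The i-th smallest element of the finite set X, counted from 1. *)
definition nth_smallest :: "nat set \<Rightarrow> nat \<Rightarrow> nat" where
  "nth_smallest X i = sorted_list_of_set X ! (i - 1)"

(* The restriction to X \<times> Y \<times> Z, with each of the three coordinates renumbered
   increasingly by {1..m}, so that it is again an m \<times> m \<times> m array. *)
definition subcube :: "nat \<Rightarrow> nat set \<Rightarrow> nat set \<Rightarrow> nat set \<Rightarrow> array3 \<Rightarrow> array3" where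
  "subcube m X Y Z A =
     (\<lambda>(i, j, l)\<in>index_cube m. A (nth_smallest X i, nth_smallest Y j, nth_smallest Z l))"

definition is_subcube :: "nat \<Rightarrow> array3 \<Rightarrow> nat \<Rightarrow> array3 \<Rightarrow> bool" where
  "is_subcube m B w A \<longleftrightarrow>
     (\<exists>X Y Z. X \<subseteq> {1..w} \<and> Y \<subseteq> {1..w} \<and> Z \<subseteq> {1..w} \<and>
        card X = m \<and> card Y = m \<and> card Z = m \<and> B = subcube m X Y Z A)"

end

theory Submission imports Defs begin

text \<open>
  Passing from a 0/1 array \<open>A\<close> to the sign array \<open>1 - 2A\<close>, the cube property says that parallel
  layers are orthogonal and that all layers have the same sum.  Both properties are preserved by
  tensor products, so it suffices to find a sign array \<open>M\<close> of size \<open>v\<^sup>3\<close> with layer sum \<open>v\<^sup>4\<close>: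
  the larger cube is then \<open>M \<otimes> M\<close>, which contains \<open>M\<close> as the part where
  the second factor sits at a fixed entry equal to 1.  Indexing the rows and columns of \<open>H\<close>
  by pairs of residues modulo \<open>v\<close>, and \<open>M\<close> by triples of residues, one can take
  \<open>M(a, b, c) = H(x, y) H(z, y)\<close> with \<open>x = (c\<^sub>1, c\<^sub>2)\<close>, \<open>z = (a\<^sub>1, b\<^sub>1)\<close> and
  \<open>y = (a\<^sub>2 + b\<^sub>2, a\<^sub>3 + b\<^sub>3 + c\<^sub>3)\<close>.
\<close>

section \<open>Sign arrays and their tensor products\<close>

text \<open>Layers are taken in the first argument only. The other two directions are reached by
  permuting the arguments, as in \<open>sign_cube\<close>, so that most facts are proved for one
  direction.\<close>

definition orth_layers :: "'a set \<Rightarrow> int \<Rightarrow> ('a \<Rightarrow> 'a \<Rightarrow> 'a \<Rightarrow> int) \<Rightarrow> bool" where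
  "orth_layers I s M \<longleftrightarrow>
     (\<forall>a\<in>I. (\<Sum>b\<in>I. \<Sum>c\<in>I. M a b c) = s) \<and>
     (\<forall>a\<in>I. \<forall>a'\<in>I. a \<noteq> a' \<longrightarrow> (\<Sum>b\<in>I. \<Sum>c\<in>I. M a b c * M a' b c) = 0)"

definition sign_cube :: "'a set \<Rightarrow> int \<Rightarrow> ('a \<Rightarrow> 'a \<Rightarrow> 'a \<Rightarrow> int) \<Rightarrow> bool" where
  "sign_cube I s M \<longleftrightarrow>
     (\<forall>a\<in>I. \<forall>b\<in>I. \<forall>c\<in>I. M a b c \<in> {1, -1}) \<and>
     orth_layers I s M \<and>
     orth_layers I s (\<lambda>b a c. M a b c) \<and>
     orth_layers I s (\<lambda>c a b. M a b c)"

definition tensor_array ::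
    "('a \<Rightarrow> 'a \<Rightarrow> 'a \<Rightarrow> int) \<Rightarrow> 'a \<times> 'a \<Rightarrow> 'a \<times> 'a \<Rightarrow> 'a \<times> 'a \<Rightarrow> int" where
  "tensor_array M a b c = M (fst a) (fst b) (fst c) * M (snd a) (snd b) (snd c)"

lemma sum_tensor:
  fixes f g :: "'a \<Rightarrow> 'a \<Rightarrow> int"
  shows "(\<Sum>b\<in>I \<times> I. \<Sum>c\<in>I \<times> I. f (fst b) (fst c) * g (snd b) (snd c)) =
         (\<Sum>b\<in>I. \<Sum>c\<in>I. f b c) * (\<Sum>b\<in>I. \<Sum>c\<in>I. g b c)"
proof -
  have "(\<Sum>c\<in>I \<times> I. F (fst c) * G (snd c)) = sum F I * sum G I" for F G :: "'a \<Rightarrow> int"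
    by (simp add: sum_product sum.cartesian_product case_prod_beta)
  then show ?thesis by simp
qed

text \<open>Sums over a layer, and scalar products of two layers, factor into one contribution from
  each tensor factor. Distinct pairs \<open>a\<close>, \<open>a'\<close> differ in some component,
  and the contribution of that component is 0. The product is written out so that permuted versions
  of \<open>M\<close> can be substituted.\<close>

lemma orth_layers_tensor:
  assumes "orth_layers I s M"
  shows "orth_layers (I \<times> I) (s * s)
           (\<lambda>a b c. M (fst a) (fst b) (fst c) * M (snd a) (snd b) (snd c))"
  unfolding orth_layers_def
proof (intro conjI ballI impI)
  fix a assume "a \<in> I \<times> I"
  then show "(\<Sum>b\<in>I \<times> I. \<Sum>c\<in>I \<times> I. M (fst a) (fst b) (fst c) * M (snd a) (snd b) (snd c)) = s * s"
    using assms by (auto simp: sum_tensor[where f = "M (fst a)" and g = "M (snd a)"] orth_layers_def)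
next
  fix a a' assume a: "a \<in> I \<times> I" "a' \<in> I \<times> I" "a \<noteq> a'"
  have "(\<Sum>b\<in>I \<times> I. \<Sum>c\<in>I \<times> I. M (fst a) (fst b) (fst c) * M (snd a) (snd b) (snd c) *
          (M (fst a') (fst b) (fst c) * M (snd a') (snd b) (snd c))) =
        (\<Sum>b\<in>I \<times> I. \<Sum>c\<in>I \<times> I. (M (fst a) (fst b) (fst c) * M (fst a') (fst b) (fst c)) *
          (M (snd a) (snd b) (snd c) * M (snd a') (snd b) (snd c)))"
    by (simp only: mult_ac)
  also have "\<dots> = (\<Sum>b\<in>I. \<Sum>c\<in>I. M (fst a) b c * M (fst a') b c) *
                 (\<Sum>b\<in>I. \<Sum>c\<in>I. M (snd a) b c * M (snd a') b c)"
    by (rule sum_tensor)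
  also have "\<dots> = 0"
    using assms a by (auto simp: orth_layers_def mem_Times_iff prod_eq_iff)
  finally show "(\<Sum>b\<in>I \<times> I. \<Sum>c\<in>I \<times> I. M (fst a) (fst b) (fst c) * M (snd a) (snd b) (snd c) *
          (M (fst a') (fst b) (fst c) * M (snd a') (snd b) (snd c))) = 0" .
qed

lemma sign_cube_tensor:
  assumes "sign_cube I s M"
  shows "sign_cube (I \<times> I) (s * s) (tensor_array M)"
proof -
  have "\<forall>a\<in>I \<times> I. \<forall>b\<in>I \<times> I. \<forall>c\<in>I \<times> I. tensor_array M a b c \<in> {1, -1}"
  proof (intro ballI)
    fix a b c assume "a \<in> I \<times> I" "b \<in> I \<times> I" "c \<in> I \<times> I"
    then have "M (fst a) (fst b) (fst c) \<in> {1, -1}" "M (snd a) (snd b) (snd c) \<in> {1, -1}"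
      using assms by (auto simp: sign_cube_def mem_Times_iff)
    then show "tensor_array M a b c \<in> {1, -1}"
      by (auto simp: tensor_array_def)
  qed
  moreover have "orth_layers (I \<times> I) (s * s) (\<lambda>a b c. tensor_array M a b c)"
    "orth_layers (I \<times> I) (s * s) (\<lambda>b a c. tensor_array M a b c)"
    "orth_layers (I \<times> I) (s * s) (\<lambda>c a b. tensor_array M a b c)"
    using assms orth_layers_tensor[of I s M] orth_layers_tensor[of I s "\<lambda>b a c. M a b c"]
      orth_layers_tensor[of I s "\<lambda>c a b. M a b c"]
    unfolding tensor_array_def sign_cube_def by blast+
  ultimately show ?thesis
    unfolding sign_cube_def by blast
qed

section \<open>From sign arrays to 0/1 cubes\<close>

text \<open>Sign x becomes entry (1 - x) / 2. The axes get three separate numberings because the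
  subcube found later inherits a different one on each axis.\<close>

definition cube_of_signs :: "nat \<Rightarrow> (nat \<Rightarrow> 'a) \<Rightarrow> (nat \<Rightarrow> 'a) \<Rightarrow> (nat \<Rightarrow> 'a) \<Rightarrow>
    ('a \<Rightarrow> 'a \<Rightarrow> 'a \<Rightarrow> int) \<Rightarrow> array3" where
  "cube_of_signs w g1 g2 g3 M =
     (\<lambda>(i, j, l)\<in>index_cube w. if M (g1 i) (g2 j) (g3 l) = 1 then 0 else 1)"

text \<open>Summing (1 - x) / 2 over the w^2 positions of a layer gives the number of ones.
  Expanding (1 - x)(1 - y) / 4 for two layers gives the sums w^2, s, s and 0 of the terms 1, x, y
  and xy. Leaving \<open>L\<close> abstract lets the same count serve all three directions.\<close>

lemma layer_counts:
  fixes L :: "nat \<Rightarrow> nat \<times> nat \<Rightarrow> nat"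
  assumes N: "orth_layers I s N"
    and g: "bij_betw g1 {1..w} I" "bij_betw g2 {1..w} I" "bij_betw g3 {1..w} I"
    and sgn: "\<And>a b c. a \<in> I \<Longrightarrow> b \<in> I \<Longrightarrow> c \<in> I \<Longrightarrow> N a b c \<in> {1, -1}"
    and L: "\<And>a p q. a \<in> {1..w} \<Longrightarrow> p \<in> {1..w} \<Longrightarrow> q \<in> {1..w} \<Longrightarrow>
              L a (p, q) = (if N (g1 a) (g2 p) (g3 q) = 1 then 0 else 1)"
  shows "(\<forall>a\<in>{1..w}. real (card {p \<in> index_square w. L a p = 1}) = (real w ^ 2 - of_int s) / 2) \<and>
         (\<forall>a\<in>{1..w}. \<forall>b\<in>{1..w}. a \<noteq> b \<longrightarrow>
            real (\<Sum>p\<in>index_square w. L a p * L b p) = (real w ^ 2 - 2 * of_int s) / 4)"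
proof -
  have gI: "g1 i \<in> I" "g2 i \<in> I" "g3 i \<in> I" if "i \<in> {1..w}" for i
    using g that by (auto dest: bij_betwE)
  have Lreal: "real (L a (p, q)) = (1 - real_of_int (N (g1 a) (g2 p) (g3 q))) / 2"
    if "a \<in> {1..w}" "p \<in> {1..w}" "q \<in> {1..w}" for a p q
    using sgn[of "g1 a" "g2 p" "g3 q"] gI that L[of a p q] by auto
  have reidx: "(\<Sum>(p, q)\<in>index_square w. f (g2 p) (g3 q)) = (\<Sum>b\<in>I. \<Sum>c\<in>I. f b c)"
    for f :: "'a \<Rightarrow> 'a \<Rightarrow> int"
  proof -
    have "(\<Sum>(p, q)\<in>index_square w. f (g2 p) (g3 q)) = (\<Sum>p\<in>{1..w}. \<Sum>q\<in>{1..w}. f (g2 p) (g3 q))"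
      by (rule sum.cartesian_product[symmetric])
    also have "\<dots> = (\<Sum>p\<in>{1..w}. \<Sum>c\<in>I. f (g2 p) c)"
      by (intro sum.cong refl sum.reindex_bij_betw[OF g(3)])
    also have "\<dots> = (\<Sum>b\<in>I. \<Sum>c\<in>I. f b c)"
      by (rule sum.reindex_bij_betw[OF g(2)])
    finally show ?thesis .
  qed
  have S: "(\<Sum>(p, q)\<in>index_square w. real_of_int (N (g1 a) (g2 p) (g3 q))) = of_int s"
    if "a \<in> {1..w}" for a
  proof -
    have "(\<Sum>(p, q)\<in>index_square w. N (g1 a) (g2 p) (g3 q)) = s"
      unfolding reidx using N gI(1)[OF that] by (simp add: orth_layers_def)
    then have "real_of_int (\<Sum>(p, q)\<in>index_square w. N (g1 a) (g2 p) (g3 q)) = of_int s"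
      by (rule arg_cong)
    then show ?thesis
      by (simp add: case_prod_beta)
  qed
  have ones: "real (card {p \<in> index_square w. L a p = 1}) = (real w ^ 2 - of_int s) / 2"
    if a: "a \<in> {1..w}" for a
  proof -
    have "card {p \<in> index_square w. L a p = 1} = (\<Sum>p\<in>index_square w. if L a p = 1 then 1 else 0)"
      by (simp add: sum.If_cases Int_def)
    also have "\<dots> = (\<Sum>p\<in>index_square w. L a p)"
      using a by (intro sum.cong) (auto simp: L split: if_splits)
    finally have "real (card {p \<in> index_square w. L a p = 1}) = (\<Sum>p\<in>index_square w. real (L a p))"
      by simp
    also have "\<dots> = (\<Sum>(p, q)\<in>index_square w. (1 - real_of_int (N (g1 a) (g2 p) (g3 q))) / 2)"
      using a by (intro sum.cong) (auto simp: Lreal)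
    also have "\<dots> = (real w ^ 2 - of_int s) / 2"
      using S[OF a]
      by (simp add: case_prod_beta sum_divide_distrib[symmetric] sum_subtractf power2_eq_square)
    finally show ?thesis .
  qed
  have products: "real (\<Sum>p\<in>index_square w. L a p * L b p) = (real w ^ 2 - 2 * of_int s) / 4"
    if a: "a \<in> {1..w}" and b: "b \<in> {1..w}" and ab: "a \<noteq> b" for a b
  proof -
    have "g1 a \<noteq> g1 b"
      using inj_on_eq_iff[OF bij_betw_imp_inj_on[OF g(1)] a b] ab by simp
    then have "(\<Sum>(p, q)\<in>index_square w. N (g1 a) (g2 p) (g3 q) * N (g1 b) (g2 p) (g3 q)) = 0"
      unfolding reidx[of "\<lambda>x y. N (g1 a) x y * N (g1 b) x y"]
      using N gI(1)[OF a] gI(1)[OF b] by (simp add: orth_layers_def)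
    then have "real_of_int (\<Sum>(p, q)\<in>index_square w. N (g1 a) (g2 p) (g3 q) * N (g1 b) (g2 p) (g3 q)) = 0"
      by (simp only: of_int_0)
    then have P: "(\<Sum>p\<in>index_square w. real_of_int (N (g1 a) (g2 (fst p)) (g3 (snd p))) *
                      real_of_int (N (g1 b) (g2 (fst p)) (g3 (snd p)))) = 0"
      by (simp add: case_prod_beta)
    have "real (\<Sum>p\<in>index_square w. L a p * L b p) =
        (\<Sum>p\<in>index_square w. real (L a p) * real (L b p))"
      by simp
    also have "\<dots> = (\<Sum>p\<in>index_square w.
        (1 - real_of_int (N (g1 a) (g2 (fst p)) (g3 (snd p)))
         - real_of_int (N (g1 b) (g2 (fst p)) (g3 (snd p)))
         + real_of_int (N (g1 a) (g2 (fst p)) (g3 (snd p))) *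
           real_of_int (N (g1 b) (g2 (fst p)) (g3 (snd p)))) / 4)"
      using a b by (intro sum.cong) (auto simp: Lreal field_simps)
    also have "\<dots> = (real w ^ 2 - 2 * of_int s) / 4"
      using S[OF a] S[OF b] P
      by (simp add: case_prod_beta sum_divide_distrib[symmetric] sum_subtractf sum.distrib
          power2_eq_square)
    finally show ?thesis .
  qed
  show ?thesis
    using ones products by blast
qed

lemma cube_of_signs_in_C33:
  assumes M: "sign_cube I s M"
    and g: "bij_betw g1 {1..w} I" "bij_betw g2 {1..w} I" "bij_betw g3 {1..w} I"
    and k: "k = (real w ^ 2 - of_int s) / 2" and lam: "lam = (real w ^ 2 - 2 * of_int s) / 4"
  shows "cube_of_signs w g1 g2 g3 M \<in> C33 w k lam"
proof -
  let ?A = "cube_of_signs w g1 g2 g3 M"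
  have sgn: "M a b c \<in> {1, -1}" if "a \<in> I" "b \<in> I" "c \<in> I" for a b c
    using M that by (auto simp: sign_cube_def)
  have orth: "orth_layers I s M" "orth_layers I s (\<lambda>b a c. M a b c)" "orth_layers I s (\<lambda>c a b. M a b c)"
    using M by (auto simp: sign_cube_def)
  define counts where "counts = (\<lambda>L :: array3 \<Rightarrow> nat \<Rightarrow> nat \<times> nat \<Rightarrow> nat.
      (\<forall>a\<in>{1..w}. real (card {p \<in> index_square w. L ?A a p = 1}) = k) \<and>
      (\<forall>a\<in>{1..w}. \<forall>b\<in>{1..w}. a \<noteq> b \<longrightarrow>
         real (\<Sum>p\<in>index_square w. L ?A a p * L ?A b p) = lam))"
  have "counts layer1"
    unfolding counts_def k lam
    by (rule layer_counts[OF orth(1) g(1) g(2) g(3)])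
       (use sgn in \<open>auto simp: layer1_def cube_of_signs_def\<close>)
  moreover have "counts layer2"
    unfolding counts_def k lam
    by (rule layer_counts[OF orth(2) g(2) g(1) g(3)])
       (use sgn in \<open>auto simp: layer2_def cube_of_signs_def\<close>)
  moreover have "counts layer3"
    unfolding counts_def k lam
    by (rule layer_counts[OF orth(3) g(3) g(1) g(2)])
       (use sgn in \<open>auto simp: layer3_def cube_of_signs_def\<close>)
  ultimately have "\<forall>L\<in>{layer1, layer2, layer3}. counts L"
    by simp
  moreover have "?A \<in> index_cube w \<rightarrow>\<^sub>E {0, 1}"
    by (auto simp: cube_of_signs_def PiE_def extensional_def)
  ultimately show ?thesis
    unfolding C33_def counts_def by (intro CollectI conjI)
qed

section \<open>The subcube inside the tensor product\<close>

lemma bij_betw_nth_smallest: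
  assumes "finite X"
  shows "bij_betw (nth_smallest X) {1..card X} X"
proof -
  have "bij_betw ((!) (sorted_list_of_set X)) {..<length (sorted_list_of_set X)}
          (set (sorted_list_of_set X))"
    by (intro bij_betw_nth) auto
  then have "bij_betw ((!) (sorted_list_of_set X)) {..<card X} X"
    using assms by simp
  \<comment> \<open>Ranks are counted from 1, list positions from 0.\<close>
  moreover have "bij_betw (\<lambda>i. i - 1) {1..card X} {..<card X}"
    by (rule bij_betw_byWitness[where f' = Suc]) auto
  ultimately show ?thesis
    using bij_betw_trans by (fastforce simp: nth_smallest_def[abs_def] comp_def)
qed

text \<open>Restrict the three coordinates to the pairs with second component \<open>p1\<close>,
  \<open>p2\<close>, \<open>p3\<close> respectively. The second tensor factor is then constantly 1,
  and what remains is \<open>M\<close> in the first components. The numbering of these components is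
  dictated by the increasing renumbering in \<open>subcube\<close>, but the cube property holds for
  any numbering.\<close>

lemma sign_cube_tensor_subcube:
  fixes M :: "'a \<Rightarrow> 'a \<Rightarrow> 'a \<Rightarrow> int"
  assumes M: "sign_cube I s M" and fin: "finite I" "card I = w"
    and p: "p1 \<in> I" "p2 \<in> I" "p3 \<in> I" "M p1 p2 p3 = 1"
    and G: "bij_betw G {1..w * w} (I \<times> I)"
    and k: "k = (real w ^ 2 - of_int s) / 2" and lam: "lam = (real w ^ 2 - 2 * of_int s) / 4"
  shows "\<exists>B \<in> C33 w k lam. is_subcube w B (w * w) (cube_of_signs (w * w) G G G (tensor_array M))"
proof -
  \<comment> \<open>\<open>X r\<close> is the fibre over \<open>r\<close> of the second component,
    and \<open>g r\<close> numbers \<open>I\<close> through that fibre in increasing order of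
    position.\<close>
  define X where "X = (\<lambda>r. {i \<in> {1..w * w}. snd (G i) = r})"
  define g where "g = (\<lambda>r i. fst (G (nth_smallest (X r) i)))"
  have fst_bij: "bij_betw (\<lambda>i. fst (G i)) (X r) I" if "r \<in> I" for r
  proof -
    have "bij_betw G (X r) (I \<times> {r})"
    proof (rule bij_betw_subset[OF G])
      show "X r \<subseteq> {1..w * w}" by (auto simp: X_def)
      have "G ` {1..w * w} = I \<times> I" using G by (simp add: bij_betw_def)
      moreover have "G ` X r = {y \<in> G ` {1..w * w}. snd y = r}" by (auto simp: X_def)
      ultimately show "G ` X r = I \<times> {r}" using that by auto
    qed
    moreover have "bij_betw fst (I \<times> {r}) I"
      by (auto simp: bij_betw_def inj_on_def)
    ultimately show ?thesis
      using bij_betw_trans by (fastforce simp: comp_def)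
  qed
  have card_X: "card (X r) = w" if "r \<in> I" for r
    using bij_betw_same_card[OF fst_bij[OF that]] fin by simp
  have finX: "finite (X r)" for r by (simp add: X_def)
  have nth_bij: "bij_betw (nth_smallest (X r)) {1..w} (X r)" if "r \<in> I" for r
    using bij_betw_nth_smallest[OF finX, of r] card_X[OF that] by simp
  have g_bij: "bij_betw (g r) {1..w} I" if "r \<in> I" for r
    using bij_betw_trans[OF nth_bij[OF that] fst_bij[OF that]] by (simp add: g_def comp_def)
  let ?A = "cube_of_signs (w * w) G G G (tensor_array M)"
  let ?B = "cube_of_signs w (g p1) (g p2) (g p3) M"
  have nthX: "nth_smallest (X r) i \<in> {1..w * w}" "snd (G (nth_smallest (X r) i)) = r"
    if "r \<in> I" "i \<in> {1..w}" for r i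
    using bij_betwE[OF nth_bij[OF that(1)]] that(2) by (auto simp: X_def)
  have "?B = subcube w (X p1) (X p2) (X p3) ?A"
    unfolding subcube_def
    by (subst cube_of_signs_def, rule restrict_ext)
       (use nthX p in \<open>auto simp: cube_of_signs_def tensor_array_def g_def\<close>)
  then have "is_subcube w ?B (w * w) ?A"
    unfolding is_subcube_def using card_X p by (intro exI[of _ "X p1"] exI[of _ "X p2"] exI[of _ "X p3"])
      (auto simp: X_def)
  moreover have "?B \<in> C33 w k lam"
    using cube_of_signs_in_C33[OF M] g_bij p k lam by blast
  ultimately show ?thesis by blast
qed

section \<open>Hadamard matrices indexed by pairs of residues\<close>

text \<open>This is a Hadamard matrix whose rows and columns are indexed by an arbitrary
  set.\<close>

definition orth_square :: "'b set \<Rightarrow> ('b \<Rightarrow> 'b \<Rightarrow> int) \<Rightarrow> bool" where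
  "orth_square P h \<longleftrightarrow>
     (\<forall>x\<in>P. \<forall>y\<in>P. h x y \<in> {1, -1}) \<and>
     (\<forall>x\<in>P. \<forall>x'\<in>P. x \<noteq> x' \<longrightarrow> (\<Sum>y\<in>P. h x y * h x' y) = 0) \<and>
     (\<forall>y\<in>P. \<forall>y'\<in>P. y \<noteq> y' \<longrightarrow> (\<Sum>x\<in>P. h x y * h x y') = 0)"

lemma orth_square_sq:
  assumes "orth_square P h" "x \<in> P" "y \<in> P"
  shows "h x y * h x y = 1"
proof -
  have "h x y \<in> {1, -1}" using assms by (auto simp: orth_square_def)
  then show ?thesis by auto
qed

lemma orth_square_rows:
  assumes "orth_square P h" "x \<in> P" "z \<in> P"
  shows "(\<Sum>y\<in>P. h x y * h z y) = (if x = z then int (card P) else 0)"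
  using assms orth_square_sq[OF assms(1,2)] by (auto simp: orth_square_def)

text \<open>Writing an index below v^2 with two digits in base v identifies it with a pair of
  residues. Rows and columns are only relabelled, so orthogonality carries over.\<close>

lemma orth_square_hadamard:
  assumes H: "hadamard_matrix (v ^ 2) H"
  shows "orth_square ({..<v} \<times> {..<v}) (\<lambda>x y. H $$ (fst x * v + snd x, fst y * v + snd y))"
proof -
  let ?P = "{..<v} \<times> {..<v}"
  let ?e = "\<lambda>x. fst x * v + snd x"
  have bij: "bij_betw ?e ?P {0..<v ^ 2}"
  proof (rule bij_betw_byWitness[where f' = "\<lambda>k. (k div v, k mod v)"])
    show "?e ` ?P \<subseteq> {0..<v ^ 2}"
    proof clarsimp
      fix a b assume "a < v" "b < v"
      then have "a * v + b < (a + 1) * v" by simp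
      also have "\<dots> \<le> v * v" using \<open>a < v\<close> by (intro mult_right_mono) auto
      finally show "a * v + b < v\<^sup>2" by (simp add: power2_eq_square)
    qed
    show "(\<lambda>k. (k div v, k mod v)) ` {0..<v ^ 2} \<subseteq> ?P"
      by (cases "v = 0") (auto simp: power2_eq_square less_mult_imp_div_less)
  qed auto
  have e: "?e x < v ^ 2" if "x \<in> ?P" for x
    using bij_betwE[OF bij] that by (metis atLeastLessThan_iff)
  have inj: "?e x \<noteq> ?e x'" if "x \<in> ?P" "x' \<in> ?P" "x \<noteq> x'" for x x'
    using bij that by (metis (no_types, lifting) bij_betw_def inj_on_def)
  have car: "H \<in> carrier_mat (v ^ 2) (v ^ 2)"
    using H by (simp add: hadamard_matrix_def)
  have rows: "(\<Sum>y\<in>?P. H $$ (i, ?e y) * H $$ (j, ?e y)) = row H i \<bullet> row H j"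
    if "i < v ^ 2" "j < v ^ 2" for i j
    unfolding scalar_prod_def using that car
    by (subst sum.reindex_bij_betw[OF bij, of "\<lambda>k. H $$ (i, k) * H $$ (j, k)"]) auto
  have cols: "(\<Sum>y\<in>?P. H $$ (?e y, i) * H $$ (?e y, j)) = col H i \<bullet> col H j"
    if "i < v ^ 2" "j < v ^ 2" for i j
    unfolding scalar_prod_def using that car
    by (subst sum.reindex_bij_betw[OF bij, of "\<lambda>k. H $$ (k, i) * H $$ (k, j)"]) auto
  show ?thesis
    unfolding orth_square_def
  proof (intro conjI ballI impI)
    fix x y assume "x \<in> ?P" "y \<in> ?P"
    then show "H $$ (?e x, ?e y) \<in> {1, -1}"
      using H e[of x] e[of y] by (simp add: hadamard_matrix_def)
  next
    fix x x' assume x: "x \<in> ?P" "x' \<in> ?P" "x \<noteq> x'"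
    show "(\<Sum>y\<in>?P. H $$ (?e x, ?e y) * H $$ (?e x', ?e y)) = 0"
      unfolding rows[OF e[OF x(1)] e[OF x(2)]]
      using H e[OF x(1)] e[OF x(2)] inj[OF x] by (simp add: hadamard_matrix_def)
    show "(\<Sum>y\<in>?P. H $$ (?e y, ?e x) * H $$ (?e y, ?e x')) = 0"
      unfolding cols[OF e[OF x(1)] e[OF x(2)]]
      using H e[OF x(1)] e[OF x(2)] inj[OF x] by (simp add: hadamard_matrix_def)
  qed
qed

section \<open>Sums over residues and over triples of residues\<close>

lemma mod_add_left_inj:
  fixes a b c v :: nat
  assumes "(a + b) mod v = (a + c) mod v" "b < v" "c < v"
  shows "b = c"
proof -
  obtain q1 q2 where "a + b + v * q1 = a + c + v * q2"
    using assms(1) by (auto simp: nat_mod_eq_iff)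
  then have "b mod v = c mod v"
    unfolding nat_mod_eq_iff by (intro exI[of _ q1] exI[of _ q2]) simp
  then show ?thesis using assms by simp
qed

lemma sum_shift_mod:
  fixes f :: "nat \<Rightarrow> int"
  shows "(\<Sum>b<v. f ((a + b) mod v)) = (\<Sum>b<v. f b)"
proof (cases "v = 0")
  case False
  have inj: "inj_on (\<lambda>b. (a + b) mod v) {..<v}"
  proof (rule inj_onI)
    fix b c assume "b \<in> {..<v}" "c \<in> {..<v}" "(a + b) mod v = (a + c) mod v"
    then show "b = c"
      by (intro mod_add_left_inj[of a b v c]) auto
  qed
  moreover have "(\<lambda>b. (a + b) mod v) ` {..<v} = {..<v}"
    using inj False by (intro card_subset_eq) (auto simp: card_image)
  ultimately show ?thesis
    by (intro sum.reindex_bij_betw) (simp add: bij_betw_def)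
qed simp

lemma sum_shift_mod_pair:
  fixes f :: "nat \<times> nat \<Rightarrow> int"
  shows "(\<Sum>y\<in>{..<v} \<times> {..<v}. f ((p + fst y) mod v, (q + snd y) mod v)) =
         (\<Sum>y\<in>{..<v} \<times> {..<v}. f y)"
proof -
  have "(\<Sum>y\<in>{..<v} \<times> {..<v}. f ((p + fst y) mod v, (q + snd y) mod v)) =
      (\<Sum>a<v. \<Sum>b<v. f ((p + a) mod v, (q + b) mod v))"
    by (simp add: sum.cartesian_product case_prod_beta)
  also have "\<dots> = (\<Sum>a<v. \<Sum>b<v. f (a, b))"
    by (simp add: sum_shift_mod[of "\<lambda>b. f (_, b)"] sum_shift_mod[of "\<lambda>a. \<Sum>b<v. f (a, b)"])
  finally show ?thesis
    by (simp add: sum.cartesian_product)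
qed

text \<open>This isolates the variables of the base array. In the first form t = (b1, c3), y = (b2,
  b3), x = (c1, c2); in the second t = (a2, a3), y = (b2, b3), z = (a1, b1). Once the layer and t
  are fixed, the column index of \<open>h\<close> is a translate of y, while x or z runs over all
  rows.\<close>

lemma sum_triples_regroup:
  fixes F :: "'a \<times> 'a \<times> 'a \<Rightarrow> 'a \<times> 'a \<times> 'a \<Rightarrow> int"
  shows "(\<Sum>b\<in>D \<times> D \<times> D. \<Sum>c\<in>D \<times> D \<times> D. F b c) =
           (\<Sum>t\<in>D \<times> D. \<Sum>y\<in>D \<times> D. \<Sum>x\<in>D \<times> D. F (fst t, y) (fst x, snd x, snd t))" (is "?S = ?T1")
    and "(\<Sum>a\<in>D \<times> D \<times> D. \<Sum>b\<in>D \<times> D \<times> D. F a b) =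
           (\<Sum>t\<in>D \<times> D. \<Sum>y\<in>D \<times> D. \<Sum>z\<in>D \<times> D. F (fst z, t) (snd z, y))" (is "?S = ?T2")
proof -
  have S: "?S = (\<Sum>(b, c)\<in>(D \<times> D \<times> D) \<times> (D \<times> D \<times> D). F b c)"
    by (rule sum.cartesian_product)
  also have "\<dots> = (\<Sum>(t, y, x)\<in>(D \<times> D) \<times> (D \<times> D) \<times> (D \<times> D). F (fst t, y) (fst x, snd x, snd t))"
    by (rule sum.reindex_bij_witness[where
          i = "\<lambda>(t, y, x). ((fst t, y), (fst x, snd x, snd t))" and
          j = "\<lambda>(b, c). ((fst b, snd (snd c)), snd b, (fst c, fst (snd c)))"])
       auto
  also have "\<dots> = ?T1"
    by (simp only: sum.cartesian_product[symmetric])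
  finally show "?S = ?T1" .
  note S
  also have "(\<Sum>(b, c)\<in>(D \<times> D \<times> D) \<times> (D \<times> D \<times> D). F b c) =
      (\<Sum>(t, y, z)\<in>(D \<times> D) \<times> (D \<times> D) \<times> (D \<times> D). F (fst z, t) (snd z, y))"
    by (rule sum.reindex_bij_witness[where
          i = "\<lambda>(t, y, z). ((fst z, t), (snd z, y))" and
          j = "\<lambda>(a, b). (snd a, snd b, (fst a, fst b))"])
       auto
  also have "\<dots> = ?T2"
    by (simp only: sum.cartesian_product[symmetric])
  finally show "?S = ?T2" .
qed

section \<open>Layers of the base array\<close>

text \<open>
  Only \<open>s = id\<close> is needed for the construction.  With a general permutation \<open>s\<close>, exchanging the
  first two coordinates amounts to replacing \<open>s\<close> by \<open>s \<circ> prod.swap\<close>.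
\<close>

definition base_array :: "nat \<Rightarrow> (nat \<times> nat \<Rightarrow> nat \<times> nat \<Rightarrow> int) \<Rightarrow> (nat \<times> nat \<Rightarrow> nat \<times> nat) \<Rightarrow>
    nat \<times> nat \<times> nat \<Rightarrow> nat \<times> nat \<times> nat \<Rightarrow> nat \<times> nat \<times> nat \<Rightarrow> int" where
  "base_array v h s = (\<lambda>(a1, a2, a3) (b1, b2, b3) (c1, c2, c3).
     let y = ((a2 + b2) mod v, (a3 + c3 + b3) mod v) in h (c1, c2) y * h (s (a1, b1)) y)"

lemma base_array_swap:
  "base_array v h s a b c = base_array v h (s \<circ> prod.swap) b a c"
  by (cases a; cases b; cases c) (simp add: base_array_def add_ac)

text \<open>Fix t = (b1, c3). After translating y, the layer sum is that of h x y * h z y over x and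
  y; row orthogonality leaves only x = z, worth v^2, and there are v^2 values of t. For two layers,
  distinct pairs (a2, a3) give distinct columns, and the sum over x vanishes by column
  orthogonality. If these pairs agree, the columns coincide, the sum over x contributes a constant
  factor, and the sum over y vanishes because a1 differs and \<open>s\<close> is injective, so the
  rows differ.\<close>

lemma orth_layers_base_array_first:
  fixes v :: nat
  defines "P \<equiv> {..<v} \<times> {..<v}"
  assumes h: "orth_square P h" and s: "bij_betw s P P"
  shows "orth_layers ({..<v} \<times> P) (int v ^ 4) (base_array v h s)"
  unfolding orth_layers_def
proof (intro conjI ballI impI)
  have cardP: "int (card P) = int v ^ 2" and finP: "finite P"
    by (auto simp: P_def power2_eq_square)
  fix a assume a: "a \<in> {..<v} \<times> P"
  obtain a1 a2 a3 where a_eq: "a = (a1, a2, a3)" by (cases a)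
  define z where "z = (\<lambda>t :: nat \<times> nat. s (a1, fst t))"
  have z: "z t \<in> P" if "t \<in> P" for t
    using bij_betwE[OF s] a that by (auto simp: z_def a_eq P_def)
  have "(\<Sum>b\<in>{..<v} \<times> P. \<Sum>c\<in>{..<v} \<times> P. base_array v h s a b c) =
      (\<Sum>t\<in>P. \<Sum>y\<in>P. \<Sum>x\<in>P. base_array v h s a (fst t, y) (fst x, snd x, snd t))"
    unfolding P_def by (rule sum_triples_regroup)
  also have "\<dots> = (\<Sum>t\<in>P. \<Sum>y\<in>P. \<Sum>x\<in>P. h x y * h (z t) y)"
  proof (rule sum.cong[OF refl])
    fix t
    show "(\<Sum>y\<in>P. \<Sum>x\<in>P. base_array v h s a (fst t, y) (fst x, snd x, snd t)) =
        (\<Sum>y\<in>P. \<Sum>x\<in>P. h x y * h (z t) y)"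
      \<comment> \<open>The column index is y translated by (a2, a3 + c3), with c3 the second
        component of \<open>t\<close>.\<close>
      using sum_shift_mod_pair[of "\<lambda>y. \<Sum>x\<in>P. h x y * h (z t) y" a2 v "a3 + snd t"]
      by (simp add: P_def a_eq z_def base_array_def case_prod_beta Let_def)
  qed
  also have "\<dots> = (\<Sum>t\<in>P. \<Sum>x\<in>P. \<Sum>y\<in>P. h x y * h (z t) y)"
    by (intro sum.cong refl sum.swap)
  also have "\<dots> = (\<Sum>t\<in>P. int (card P))"
    using z h finP by (intro sum.cong refl) (simp add: orth_square_rows)
  finally show "(\<Sum>b\<in>{..<v} \<times> P. \<Sum>c\<in>{..<v} \<times> P. base_array v h s a b c) = int v ^ 4"
    by (simp add: cardP flip: power_add)
next
  fix a a' assume a: "a \<in> {..<v} \<times> P" and a': "a' \<in> {..<v} \<times> P" and ne: "a \<noteq> a'"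
  obtain a1 a2 a3 where a_eq: "a = (a1, a2, a3)" by (cases a)
  obtain a1' a2' a3' where a'_eq: "a' = (a1', a2', a3')" by (cases a')
  let ?F = "\<lambda>t y x. base_array v h s a (fst t, y) (fst x, snd x, snd t) *
                   base_array v h s a' (fst t, y) (fst x, snd x, snd t)"
  have "(\<Sum>y\<in>P. \<Sum>x\<in>P. ?F t y x) = 0" if t: "t \<in> P" for t
  proof -
    define z z' where "z = s (a1, fst t)" and "z' = s (a1', fst t)"
    define Y Y' where "Y = (\<lambda>y :: nat \<times> nat. ((a2 + fst y) mod v, (a3 + snd t + snd y) mod v))"
      and "Y' = (\<lambda>y :: nat \<times> nat. ((a2' + fst y) mod v, (a3' + snd t + snd y) mod v))"
    \<comment> \<open>The two factors depending on \<open>x\<close> are collected in front; the rest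
      is constant in \<open>x\<close>.\<close>
    have F: "?F t y x = (h x (Y y) * h x (Y' y)) * (h z (Y y) * h z' (Y' y))" for x y
      by (cases x; cases y) (simp add: base_array_def Let_def a_eq a'_eq z_def z'_def Y_def Y'_def)
    have z: "z \<in> P" "z' \<in> P"
      using bij_betwE[OF s] a a' t by (auto simp: z_def z'_def a_eq a'_eq P_def)
    have YP: "Y y \<in> P" "Y' y \<in> P" if "y \<in> P" for y
      using that by (auto simp: P_def Y_def Y'_def)
    show ?thesis
    proof (cases "(a2, a3) = (a2', a3')")
      case True
      then have YY: "Y' = Y" by (simp add: Y_def Y'_def)
      have "(a1, fst t) \<in> P" "(a1', fst t) \<in> P" "(a1, fst t) \<noteq> (a1', fst t)"
        using a a' t ne True by (auto simp: a_eq a'_eq P_def)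
      then have "z \<noteq> z'"
        using s by (auto simp: z_def z'_def bij_betw_def dest: inj_onD)
      have "(\<Sum>y\<in>P. \<Sum>x\<in>P. ?F t y x) = (\<Sum>y\<in>P. int (card P) * (h z (Y y) * h z' (Y y)))"
        unfolding F YY using YP(1) by (intro sum.cong refl) (simp add: orth_square_sq[OF h])
      also have "\<dots> = int (card P) * (\<Sum>y\<in>P. h z (Y y) * h z' (Y y))"
        by (simp add: sum_distrib_left)
      also have "(\<Sum>y\<in>P. h z (Y y) * h z' (Y y)) = (\<Sum>y\<in>P. h z y * h z' y)"
        unfolding P_def Y_def by (rule sum_shift_mod_pair)
      also have "\<dots> = 0"
        using orth_square_rows[OF h z] \<open>z \<noteq> z'\<close> by simp
      finally show ?thesis by simp
    next
      case False
      have "(\<Sum>x\<in>P. ?F t y x) = 0" if y: "y \<in> P" for y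
      proof -
        have "Y y \<noteq> Y' y"
          using False a a' mod_add_left_inj[of "fst y" a2 v a2']
            mod_add_left_inj[of "snd t + snd y" a3 v a3']
          by (auto simp: Y_def Y'_def a_eq a'_eq P_def add_ac)
        then have "(\<Sum>x\<in>P. h x (Y y) * h x (Y' y)) = 0"
          using h YP[OF y] unfolding orth_square_def by blast
        then show ?thesis
          unfolding F by (simp flip: sum_distrib_right)
      qed
      then show ?thesis by simp
    qed
  qed
  then show "(\<Sum>b\<in>{..<v} \<times> P. \<Sum>c\<in>{..<v} \<times> P. base_array v h s a b c * base_array v h s a' b c) = 0"
    using sum_triples_regroup(1)[of "\<lambda>b c. base_array v h s a b c * base_array v h s a' b c" "{..<v}"]
    by (simp add: P_def)
qed

text \<open>The argument is that of the first direction with t = (a2, a3) fixed and the rows z =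
  (a1, b1) playing the part of x. If c3 differs, the columns differ and the sum over z vanishes. If
  c3 agrees, the rows (c1, c2) differ and the sum over y vanishes.\<close>

lemma orth_layers_base_array_third:
  fixes v :: nat
  defines "P \<equiv> {..<v} \<times> {..<v}"
  assumes h: "orth_square P h"
  shows "orth_layers ({..<v} \<times> P) (int v ^ 4) (\<lambda>c a b. base_array v h id a b c)"
  unfolding orth_layers_def
proof (intro conjI ballI impI)
  have cardP: "int (card P) = int v ^ 2" and finP: "finite P"
    by (auto simp: P_def power2_eq_square)
  fix c assume c: "c \<in> {..<v} \<times> P"
  obtain c1 c2 c3 where c_eq: "c = (c1, c2, c3)" by (cases c)
  define x where "x = (c1, c2)"
  have x: "x \<in> P" using c by (auto simp: x_def c_eq P_def)
  have "(\<Sum>a\<in>{..<v} \<times> P. \<Sum>b\<in>{..<v} \<times> P. base_array v h id a b c) =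
      (\<Sum>t\<in>P. \<Sum>y\<in>P. \<Sum>z\<in>P. base_array v h id (fst z, t) (snd z, y) c)"
    unfolding P_def by (rule sum_triples_regroup)
  also have "\<dots> = (\<Sum>t\<in>P. \<Sum>y\<in>P. \<Sum>z\<in>P. h x y * h z y)"
  proof (rule sum.cong[OF refl])
    fix t
    show "(\<Sum>y\<in>P. \<Sum>z\<in>P. base_array v h id (fst z, t) (snd z, y) c) =
        (\<Sum>y\<in>P. \<Sum>z\<in>P. h x y * h z y)"
      using sum_shift_mod_pair[of "\<lambda>y. \<Sum>z\<in>P. h x y * h z y" "fst t" v "snd t + c3"]
      by (cases t) (simp add: P_def c_eq x_def base_array_def case_prod_beta Let_def)
  qed
  also have "\<dots> = (\<Sum>t\<in>P. \<Sum>z\<in>P. \<Sum>y\<in>P. h x y * h z y)"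
    by (intro sum.cong refl sum.swap)
  also have "\<dots> = (\<Sum>t\<in>P. int (card P))"
    using x h finP by (intro sum.cong refl) (simp add: orth_square_rows)
  finally show "(\<Sum>a\<in>{..<v} \<times> P. \<Sum>b\<in>{..<v} \<times> P. base_array v h id a b c) = int v ^ 4"
    by (simp add: cardP flip: power_add)
next
  fix c c' assume c: "c \<in> {..<v} \<times> P" and c': "c' \<in> {..<v} \<times> P" and ne: "c \<noteq> c'"
  obtain c1 c2 c3 where c_eq: "c = (c1, c2, c3)" by (cases c)
  obtain c1' c2' c3' where c'_eq: "c' = (c1', c2', c3')" by (cases c')
  define x x' where "x = (c1, c2)" and "x' = (c1', c2')"
  have x: "x \<in> P" "x' \<in> P" using c c' by (auto simp: x_def x'_def c_eq c'_eq P_def)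
  let ?F = "\<lambda>t y z. base_array v h id (fst z, t) (snd z, y) c *
                   base_array v h id (fst z, t) (snd z, y) c'"
  have "(\<Sum>y\<in>P. \<Sum>z\<in>P. ?F t y z) = 0" if t: "t \<in> P" for t
  proof -
    define Y Y' where "Y = (\<lambda>y :: nat \<times> nat. ((fst t + fst y) mod v, (snd t + c3 + snd y) mod v))"
      and "Y' = (\<lambda>y :: nat \<times> nat. ((fst t + fst y) mod v, (snd t + c3' + snd y) mod v))"
    have F: "?F t y z = (h z (Y y) * h z (Y' y)) * (h x (Y y) * h x' (Y' y))" for y z
      by (cases t; cases y) (simp add: base_array_def Let_def c_eq c'_eq x_def x'_def Y_def Y'_def)
    have YP: "Y y \<in> P" "Y' y \<in> P" if "y \<in> P" for y
      using that by (auto simp: P_def Y_def Y'_def)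
    show ?thesis
    proof (cases "c3 = c3'")
      case True
      then have YY: "Y' = Y" by (simp add: Y_def Y'_def)
      have "x \<noteq> x'"
        using ne True by (auto simp: x_def x'_def c_eq c'_eq)
      have "(\<Sum>y\<in>P. \<Sum>z\<in>P. ?F t y z) = (\<Sum>y\<in>P. int (card P) * (h x (Y y) * h x' (Y y)))"
        unfolding F YY using YP(1) by (intro sum.cong refl) (simp add: orth_square_sq[OF h])
      also have "\<dots> = int (card P) * (\<Sum>y\<in>P. h x (Y y) * h x' (Y y))"
        by (simp add: sum_distrib_left)
      also have "(\<Sum>y\<in>P. h x (Y y) * h x' (Y y)) = (\<Sum>y\<in>P. h x y * h x' y)"
        unfolding P_def Y_def by (rule sum_shift_mod_pair)
      also have "\<dots> = 0"
        using orth_square_rows[OF h x] \<open>x \<noteq> x'\<close> by simp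
      finally show ?thesis by (simp only: mult_zero_right)
    next
      case False
      have "(\<Sum>z\<in>P. ?F t y z) = 0" if y: "y \<in> P" for y
      proof -
        have "Y y \<noteq> Y' y"
          using False c c' mod_add_left_inj[of "snd t + snd y" c3 v c3']
          by (auto simp: Y_def Y'_def c_eq c'_eq P_def add_ac)
        then have "(\<Sum>z\<in>P. h z (Y y) * h z (Y' y)) = 0"
          using h YP[OF y] unfolding orth_square_def by blast
        then show ?thesis
          unfolding F by (simp flip: sum_distrib_right)
      qed
      then show ?thesis by simp
    qed
  qed
  then show "(\<Sum>a\<in>{..<v} \<times> P. \<Sum>b\<in>{..<v} \<times> P. base_array v h id a b c * base_array v h id a b c') = 0"
    using sum_triples_regroup(2)[of "\<lambda>a b. base_array v h id a b c * base_array v h id a b c'" "{..<v}"]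
    by (simp add: P_def)
qed

lemma sign_cube_base_array:
  fixes v :: nat
  defines "P \<equiv> {..<v} \<times> {..<v}"
  assumes h: "orth_square P h"
  shows "sign_cube ({..<v} \<times> P) (int v ^ 4) (base_array v h id)"
  unfolding sign_cube_def
proof (intro conjI)
  show "\<forall>a\<in>{..<v} \<times> P. \<forall>b\<in>{..<v} \<times> P. \<forall>c\<in>{..<v} \<times> P. base_array v h id a b c \<in> {1, -1}"
  proof (intro ballI)
    fix a b c assume abc: "a \<in> {..<v} \<times> P" "b \<in> {..<v} \<times> P" "c \<in> {..<v} \<times> P"
    obtain a1 a2 a3 b1 b2 b3 c1 c2 c3
      where eq: "a = (a1, a2, a3)" "b = (b1, b2, b3)" "c = (c1, c2, c3)"
      by (cases a; cases b; cases c)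
    let ?y = "((a2 + b2) mod v, (a3 + c3 + b3) mod v)"
    have "(c1, c2) \<in> P" "(a1, b1) \<in> P" "?y \<in> P"
      using abc by (auto simp: eq P_def)
    then have "h (c1, c2) ?y \<in> {1, -1}" "h (a1, b1) ?y \<in> {1, -1}"
      using h unfolding orth_square_def by blast+
    then show "base_array v h id a b c \<in> {1, -1}"
      by (auto simp: eq base_array_def)
  qed
  have swap: "bij_betw (id \<circ> prod.swap) P P"
    by (auto simp: P_def bij_betw_def inj_on_def image_iff)
  show "orth_layers ({..<v} \<times> P) (int v ^ 4) (base_array v h id)"
    using orth_layers_base_array_first[of v h id] h by (simp add: P_def)
  \<comment> \<open>The second direction is the first one for the permutation
    \<open>id \<circ> prod.swap\<close>.\<close>
  show "orth_layers ({..<v} \<times> P) (int v ^ 4) (\<lambda>b a c. base_array v h id a b c)"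
    using orth_layers_base_array_first[of v h "id \<circ> prod.swap"] h swap
    unfolding P_def base_array_swap[of v h id] by simp
  show "orth_layers ({..<v} \<times> P) (int v ^ 4) (\<lambda>c a b. base_array v h id a b c)"
    using orth_layers_base_array_third[of v h] h by (simp add: P_def)
qed

section \<open>Assembling the two nested cubes\<close>

theorem theorem4p14:
  fixes v :: nat and H :: "int mat"
  assumes "hadamard_matrix (v ^ 2) H"
  shows "\<exists>A \<in> C33 (v ^ 6) (real v ^ 8 * (real v ^ 4 - 1) / 2) (real v ^ 8 * (real v ^ 4 - 2) / 4).
         \<exists>B \<in> C33 (v ^ 3) (real v ^ 4 * (real v ^ 2 - 1) / 2) (real v ^ 4 * (real v ^ 2 - 2) / 4).
           is_subcube (v ^ 3) B (v ^ 6) A"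
proof (cases "v = 0")
  case True
  \<comment> \<open>With empty index cubes the only extensional array is undefined everywhere, and
    all layer conditions are vacuous. This case is separate because an entry 1 of \<open>M\<close>
    has to be chosen below.\<close>
  have "subcube 0 {} {} {} (\<lambda>_. undefined) = (\<lambda>_. undefined)"
    by (simp add: subcube_def fun_eq_iff)
  then have "is_subcube 0 (\<lambda>_. undefined) 0 (\<lambda>_. undefined)"
    by (auto simp: is_subcube_def)
  moreover have "(\<lambda>_. undefined) \<in> C33 0 k lam" "(\<lambda>_. undefined) \<in> C33 0 k lam" for k lam
    by (auto simp: C33_def PiE_def extensional_def)
  ultimately show ?thesis
    using True by auto
next
  case False
  define h :: "nat \<times> nat \<Rightarrow> nat \<times> nat \<Rightarrow> int"
    where "h = (\<lambda>x y. H $$ (fst x * v + snd x, fst y * v + snd y))"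
  define I where "I = {..<v} \<times> {..<v} \<times> {..<v}"
  define M where "M = base_array v h id"
  have M: "sign_cube I (int v ^ 4) M"
    unfolding M_def I_def
    by (rule sign_cube_base_array) (simp add: h_def orth_square_hadamard[OF assms])
  have fin: "finite I" and card: "card I = v ^ 3"
    by (simp_all add: I_def power3_eq_cube)
  have zero: "(0, 0, 0) \<in> I"
    using False by (simp add: I_def)
  \<comment> \<open>A layer with positive sum v^4 cannot consist of entries -1 only.\<close>
  have "\<exists>p2\<in>I. \<exists>p3\<in>I. M (0, 0, 0) p2 p3 = 1"
  proof (rule ccontr)
    assume "\<not> ?thesis"
    then have "M (0, 0, 0) b c \<le> 0" if "b \<in> I" "c \<in> I" for b c
      using M zero that by (force simp: sign_cube_def)
    then have "(\<Sum>b\<in>I. \<Sum>c\<in>I. M (0, 0, 0) b c) \<le> 0"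
      by (intro sum_nonpos)
    moreover have "(\<Sum>b\<in>I. \<Sum>c\<in>I. M (0, 0, 0) b c) = int v ^ 4"
      using M zero by (simp add: sign_cube_def orth_layers_def)
    ultimately show False
      using False by simp
  qed
  then obtain p2 p3 where p: "p2 \<in> I" "p3 \<in> I" "M (0, 0, 0) p2 p3 = 1"
    by blast
  have w2: "v ^ 3 * v ^ 3 = v ^ 6"
    by (simp flip: power_add)
  obtain G where G: "bij_betw G {1..v ^ 3 * v ^ 3} (I \<times> I)"
    using finite_same_card_bij[of "{1..v ^ 3 * v ^ 3}" "I \<times> I"] fin card
    by (auto simp: card_cartesian_product)
  let ?A = "cube_of_signs (v ^ 3 * v ^ 3) G G G (tensor_array M)"
  \<comment> \<open>Here the side is v^6 and the layer sum v^8, so k = (v^12 - v^8) / 2 and lambda =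
    (v^12 - 2 v^8) / 4. For the subcube below, the side is v^3 and the layer sum v^4.\<close>
  have "?A \<in> C33 (v ^ 3 * v ^ 3) (real v ^ 8 * (real v ^ 4 - 1) / 2) (real v ^ 8 * (real v ^ 4 - 2) / 4)"
    by (rule cube_of_signs_in_C33[OF sign_cube_tensor[OF M] G G G])
       (simp_all add: algebra_simps flip: power_add power_mult)
  moreover have "\<exists>B \<in> C33 (v ^ 3) (real v ^ 4 * (real v ^ 2 - 1) / 2) (real v ^ 4 * (real v ^ 2 - 2) / 4).
      is_subcube (v ^ 3) B (v ^ 3 * v ^ 3) ?A"
    by (rule sign_cube_tensor_subcube[OF M fin card zero p G])
       (simp_all add: algebra_simps flip: power_add power_mult)
  ultimately show ?thesis
    unfolding w2 by blast
qed

end
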